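(* Let $K$ be a field and let $\ldots x_{-1}a_{-1}x_0a_0x_1a_1x_2a_2\ldots$ be an admissible frontier with variables $a_i\in K^*$, embedded in $\mathbb Z^2$. Then there exists a unique tame $SL_2$-tiling $t:\mathbb Z^2\to K$ of the plane over $K$ extending the embedding of the frontier into the plane (i.e. $t(P_i)=a_i$ for all $i\in\mathbb Z$, where $P_i$ is the point labelled by $a_i$). It is given, for any point $(u,v)$ below the frontier, with associated word written $a_0x_1a_1x_2\cdots x_{n+1}a_{n+1}$ (after renumbering), where $n\ge1$ and $x_i\in\{x,y\}$, by the formula $$t(u,v)=\frac{1}{a_1a_2\cdots a_n}\,(1,a_0)\,\mu(a_1,x_2,a_2)\,\mu(a_2,x_3,a_3)\cdots\mu(a_{n-1},x_n,a_n)\begin{pmatrix} 1 \\ a_{n+1} \end{pmatrix},$$ where $$\mu(a,x,b)=\begin{pmatrix} a&1 \\ 0&b \end{pmatrix},\qquad \mu(a,y,b)=\begin{pmatrix} b&0 \\ 1&a \end{pmatrix}.$$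
   Context: The plane $\mathbb Z^2$ is drawn with first coordinate axis pointing right and second coordinate axis pointing down. An $SL_2$-tiling of the plane over a field $K$ is a map $t:\mathbb Z^2\to K$ with $t(u,v)t(u+1,v+1)-t(u+1,v)t(u,v+1)=1$ for all $u,v\in\mathbb Z$. It is tame if, viewed as a bi-infinite matrix (rows indexed by $v$, columns by $u$), its rank is $2$. A frontier is a bi-infinite sequence $\ldots x_{-1}a_{-1}x_0a_0x_1a_1\ldots$ with $x_i\in\{x,y\}$ and $a_i\in K^*$ (the variables) for $i\in\mathbb Z$; it is admissible if neither $(x_n)_{n\ge0}$ nor $(x_n)_{n\le0}$ is ultimately constant. It is embedded in the plane (uniquely up to translation) by choosing points $P_i\in\mathbb Z^2$, $P_i$ labelled by $a_i$, with $P_i-P_{i-1}=(1,0)$ if $x_i=x$ and $P_i-P_{i-1}=(0,-1)$ if $x_i=y$. A point $(u,v)$ is below the frontier if it is not one of the $P_i$ and some $P_i=(u,v')$ has $v'<v$. The word associated to a point $(u,v)$ below the frontier is obtained by projecting it horizontally (to the left) and vertically (upwards) onto the frontier: if $P_i$ is the rightmost frontier point in row $v$ (largest index $i$) and $P_j$ the lowest frontier point in column $u$ (smallest index $j$), the word is $a_ix_{i+1}a_{i+1}x_{i+2}\cdots x_ja_j$. The empty product of $2\times2$ matrices (case $n=1$) is the identity. *)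

theory Defs
  imports "HOL-Analysis.Analysis" "HOL-Library.Function_Algebras"
begin

type_synonym 'a tiling = "int \<times> int \<Rightarrow> 'a"

definition SL2_tiling :: "'a::field tiling \<Rightarrow> bool" where
  "SL2_tiling t \<longleftrightarrow>
     (\<forall>u v. t (u, v) * t (u + 1, v + 1) - t (u + 1, v) * t (u, v + 1) = 1)"

global_interpretation fun_space: vector_space "\<lambda>(c::'a::field) (f::'i \<Rightarrow> 'a) k. c * f k"
  by unfold_locales (auto simp: fun_eq_iff algebra_simps)

text \<open>
  The rank of a bi-infinite matrix (rows indexed by v, columns by u) is the dimension of the
  space spanned by its rows.  The library assigns dimension 0 to infinite-dimensional spaces,
  so the value 2 below does mean that the row space has a basis of exactly two elements.
\<close>

definition tiling_rank :: "'a::field tiling \<Rightarrow> nat" where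
  "tiling_rank t = fun_space.dim (range (\<lambda>v u. t (u, v)))"

definition tame :: "'a::field tiling \<Rightarrow> bool" where
  "tame t \<longleftrightarrow> tiling_rank t = 2"

datatype letter = X | Y

text \<open>
  In a frontier with letters \<open>x i\<close> and variables \<open>a i\<close>, the letter \<open>x i\<close> stands between
  \<open>a (i - 1)\<close> and \<open>a i\<close>.
\<close>

definition admissible :: "(int \<Rightarrow> letter) \<Rightarrow> bool" where
  "admissible x \<longleftrightarrow>
     \<not> (\<exists>c. eventually (\<lambda>n. x n = c) at_top) \<and> \<not> (\<exists>c. eventually (\<lambda>n. x n = c) at_bot)"

text \<open>The second coordinate axis points down, so that a letter \<open>Y\<close> is a step upwards.\<close>

definition embedding :: "(int \<Rightarrow> letter) \<Rightarrow> (int \<Rightarrow> int \<times> int) \<Rightarrow> bool" where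
  "embedding x P \<longleftrightarrow>
     (\<forall>i. P i = (case x i of
        X \<Rightarrow> (fst (P (i - 1)) + 1, snd (P (i - 1)))
      | Y \<Rightarrow> (fst (P (i - 1)), snd (P (i - 1)) - 1)))"

definition extends_frontier ::
    "'a tiling \<Rightarrow> (int \<Rightarrow> int \<times> int) \<Rightarrow> (int \<Rightarrow> 'a) \<Rightarrow> bool" where
  "extends_frontier t P a \<longleftrightarrow> (\<forall>i. t (P i) = a i)"

definition below :: "(int \<Rightarrow> int \<times> int) \<Rightarrow> int \<times> int \<Rightarrow> bool" where
  "below P p \<longleftrightarrow> p \<notin> range P \<and> (\<exists>i. fst (P i) = fst p \<and> snd (P i) < snd p)"

text \<open>
  Indices of the horizontal projection to the left (rightmost frontier point in row \<open>v\<close>) and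
  of the vertical projection upwards (lowest frontier point in column \<open>u\<close>).
\<close>

definition left_index :: "(int \<Rightarrow> int \<times> int) \<Rightarrow> int \<Rightarrow> int" where
  "left_index P v = (GREATEST i. snd (P i) = v)"

definition up_index :: "(int \<Rightarrow> int \<times> int) \<Rightarrow> int \<Rightarrow> int" where
  "up_index P u = (LEAST j. fst (P j) = u)"

fun mu :: "'a::field \<Rightarrow> letter \<Rightarrow> 'a \<Rightarrow> 'a^2^2" where
  "mu a X b = vector [vector [a, 1], vector [0, b]]"
| "mu a Y b = vector [vector [b, 0], vector [1, a]]"

definition matrix_prod :: "('a::field^2^2) list \<Rightarrow> 'a^2^2" where
  "matrix_prod Ms = foldr (**) Ms (mat 1)"

text \<open>
  The right-hand side of the formula for the word
  \<open>b 0, z 1, b 1, z 2, \<dots>, z (n + 1), b (n + 1)\<close>.  The product of a row, square matrices and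
  a column is a 1 by 1 matrix, whose entry is taken.
\<close>

definition word_value :: "nat \<Rightarrow> (nat \<Rightarrow> letter) \<Rightarrow> (nat \<Rightarrow> 'a::field) \<Rightarrow> 'a" where
  "word_value n z b =
     1 / (\<Prod>k=1..n. b k) *
     ((vector [vector [1, b 0]] :: 'a^2^1)
        ** matrix_prod (map (\<lambda>k. mu (b k) (z (k + 1)) (b (k + 1))) [1..<n])
        ** (vector [vector [1], vector [b (n + 1)]] :: 'a^1^2)) $ 1 $ 1"

end

theory Submission imports Defs begin

text \<open>
  Let \<open>wedge p q = det (p, q)\<close> be the symplectic form on \<open>K\<^sup>2\<close>.  If two bi-infinite sequences
  \<open>w\<close> and \<open>p\<close> of plane vectors are unimodular (consecutive vectors have wedge 1), then
  \<open>t (u, v) = wedge (w v) (p u)\<close> is a tame tiling: by the multiplicativity of the determinant, its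
  \<open>2 \<times> 2\<close> minors are products of a wedge of two \<open>p\<close>s and a wedge of two \<open>w\<close>s.  Conversely, two
  adjacent rows of a tiling are linearly independent, so in a tame tiling they span all rows, and
  the coordinates with respect to them give such a pair of sequences
  (\<open>wedge_tiling_tame\<close>, \<open>tame_imp_wedge_tiling\<close>).  The pair is unique up to the diagonal action of
  \<open>SL\<^sub>2\<close>, which can be used to fix \<open>w\<close> and \<open>p\<close> at one point where the tiling does not vanish.

  Now walk along the frontier and look at the frame \<open>(w, p)\<close> attached to each point.  A horizontal
  step keeps \<open>w\<close> and moves \<open>p\<close> to \<open>p'\<close>, where \<open>wedge p p' = 1\<close> and \<open>wedge w p' = b\<close> is prescribed.
  These are two linear equations for \<open>p'\<close>, whose determinant is, up to sign, the old value
  \<open>a = wedge w p \<noteq> 0\<close>; the solution is \<open>a p' = b p - w\<close>, by the Pluecker relation.  Vertical steps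
  are the same with \<open>w\<close> and \<open>p\<close> exchanged and the direction reversed.  So a frame at one point
  propagates along the frontier in both directions, in exactly one way
  (\<open>framing_exists\<close>, \<open>framing_unique\<close>).  Since the frontier is admissible, it meets every row and
  every column, so the frames along it are the same thing as the two sequences
  (\<open>framing_of_wedge_tiling\<close>, \<open>wedge_tiling_of_framing\<close>).  This gives existence and uniqueness.

  For the formula, the matrices \<open>\<mu>(a, x, b)\<close> are the transition matrices between consecutive frames.
  Let \<open>(w\<^sub>k, p\<^sub>k)\<close> be the frames along the word, starting at \<open>k = 0\<close>.  Multiplying the
  row \<open>(1, a\<^sub>0)\<close> by the matrices up to \<open>\<mu>(a\<^sub>m\<^sub>-\<^sub>1, x\<^sub>m, a\<^sub>m)\<close> yields \<open>a\<^sub>1 \<dots> a\<^sub>m\<^sub>-\<^sub>1\<close> times the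
  row \<open>(wedge w\<^sub>m w\<^sub>0, wedge w\<^sub>0 p\<^sub>m)\<close> (\<open>word_row\<close>).  The final column is the last
  horizontal step, so the whole product is \<open>a\<^sub>1 \<dots> a\<^sub>n\<close> times \<open>wedge w\<^sub>0 p\<^sub>n\<^sub>+\<^sub>1\<close>, and that
  wedge is the value of the tiling at the point in the row of \<open>a\<^sub>0\<close> and the column
  of \<open>a\<^sub>n\<^sub>+\<^sub>1\<close>.
\<close>

section \<open>The symplectic form on the plane\<close>

definition wedge :: "'a::field \<times> 'a \<Rightarrow> 'a \<times> 'a \<Rightarrow> 'a" where
  "wedge p q = fst p * snd q - snd p * fst q"

lemma wedge_self [simp]: "wedge p p = 0"
  by (simp add: wedge_def)

lemma wedge_antisym: "wedge q p = - wedge p q"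
  by (simp add: wedge_def)

text \<open>
  The Pluecker relation between the six minors of a \<open>2 \<times> 4\<close> matrix.  Read as an identity that is
  linear in one vector, it expresses any vector in a basis formed by two others; every relation between
  three vectors below has this form.
\<close>

lemma wedge_pluecker:
  "wedge p q * wedge r s - wedge p r * wedge q s + wedge p s * wedge q r = 0"
  by (simp add: wedge_def algebra_simps)

lemma wedge_nondegenerate:
  assumes "\<And>r. wedge r p = wedge r q"
  shows "p = q"
  using assms[of "(1, 0)"] assms[of "(0, 1)"] by (simp add: wedge_def prod_eq_iff)

section \<open>Tame tilings as Gram matrices\<close>

definition unimodular :: "(int \<Rightarrow> 'a::field \<times> 'a) \<Rightarrow> bool" where
  "unimodular f \<longleftrightarrow> (\<forall>n. wedge (f n) (f (n + 1)) = 1)"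

definition wedge_tiling :: "(int \<Rightarrow> 'a::field \<times> 'a) \<Rightarrow> (int \<Rightarrow> 'a \<times> 'a) \<Rightarrow> 'a tiling" where
  "wedge_tiling w p = (\<lambda>(u, v). wedge (w v) (p u))"

text \<open>
  Binet's formula: the matrix of the tiling is a product of an \<open>\<infinity> \<times> 2\<close> and a \<open>2 \<times> \<infinity>\<close> matrix.
\<close>

lemma wedge_tiling_minor:
  "wedge_tiling w p (u, v) * wedge_tiling w p (u', v') -
   wedge_tiling w p (u', v) * wedge_tiling w p (u, v') = wedge (p u) (p u') * wedge (w v) (w v')"
  by (simp add: wedge_tiling_def wedge_def algebra_simps)

lemma SL2_tiling_rows_independent:
  assumes "SL2_tiling t"
  shows "fun_space.independent {\<lambda>u. t (u, v), \<lambda>u. t (u, v + 1)}"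
    and "(\<lambda>u. t (u, v)) \<noteq> (\<lambda>u. t (u, v + 1))"
proof -
  have minor: "t (0, v) * t (1, v + 1) - t (1, v) * t (0, v + 1) = 1"
    using assms unfolding SL2_tiling_def by (metis add_0)
  have not_multiple: "(\<lambda>u. t (u, v)) \<noteq> (\<lambda>u. k * t (u, v + 1))" for k
  proof
    assume "(\<lambda>u. t (u, v)) = (\<lambda>u. k * t (u, v + 1))"
    then have "t (u, v) = k * t (u, v + 1)" for u by meson
    with minor show False by (simp add: algebra_simps)
  qed
  show "(\<lambda>u. t (u, v)) \<noteq> (\<lambda>u. t (u, v + 1))"
    using not_multiple[of 1] by simp
  have "(\<lambda>u. t (u, v)) \<notin> fun_space.span {\<lambda>u. t (u, v + 1)}"
    using not_multiple by (auto simp: fun_space.span_singleton)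
  moreover have "(\<lambda>u. t (u, v + 1)) \<noteq> 0"
  proof
    assume "(\<lambda>u. t (u, v + 1)) = 0"
    then have "t (u, v + 1) = 0" for u by (metis zero_fun_apply)
    with minor show False by simp
  qed
  ultimately show "fun_space.independent {\<lambda>u. t (u, v), \<lambda>u. t (u, v + 1)}"
    by (intro fun_space.independent_insertI) (simp_all add: fun_space.independent_empty)
qed

lemma in_span_pairD:
  assumes "f \<in> fun_space.span {g, h}"
  shows "\<exists>\<alpha> \<beta>. \<forall>k. f k = \<alpha> * g k + \<beta> * h k"
proof -
  from assms obtain \<alpha> \<beta> where "f - (\<lambda>k. \<alpha> * g k) = (\<lambda>k. \<beta> * h k)"
    by (auto simp: fun_space.span_breakdown_eq[of f g] fun_space.span_singleton)
  then have "f k = \<alpha> * g k + \<beta> * h k" for k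
    by (metis (no_types, lifting) diff_add_cancel add.commute fun_diff_def)
  then show ?thesis by blast
qed

lemma in_span_pairI:
  assumes "\<And>k. f k = \<alpha> * g k + \<beta> * h k"
  shows "f \<in> fun_space.span {g, h}"
proof -
  have "f = (\<lambda>k. \<alpha> * g k) + (\<lambda>k. \<beta> * h k)"
    using assms by (simp add: fun_eq_iff)
  then show ?thesis
    by (simp add: fun_space.span_add fun_space.span_scale fun_space.span_base)
qed

lemma wedge_tiling_tame:
  assumes "unimodular w" "unimodular p"
  shows "SL2_tiling (wedge_tiling w p)" and "tame (wedge_tiling w p)"
proof -
  let ?t = "wedge_tiling w p"
  show SL2: "SL2_tiling ?t"
    using assms by (simp add: SL2_tiling_def wedge_tiling_minor unimodular_def)
  let ?r = "\<lambda>v u. ?t (u, v)"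
  have "?r v \<in> fun_space.span {?r 0, ?r 1}" for v
  proof (rule in_span_pairI)
    fix u
    have "wedge (w 0) (w 1) = 1" using assms(1) unfolding unimodular_def by (metis add_0)
    then show "?r v u = - wedge (w 1) (w v) * ?r 0 u + wedge (w 0) (w v) * ?r 1 u"
      using wedge_pluecker[of "w 0" "w 1" "w v" "p u"]
      by (simp add: wedge_tiling_def algebra_simps)
  qed
  then have "fun_space.dim (range ?r) = 2"
    using SL2_tiling_rows_independent[OF SL2, of 0]
    by (intro fun_space.dim_unique[of "{?r 0, ?r 1}"]) auto
  then show "tame ?t" by (simp add: tame_def tiling_rank_def)
qed

text \<open>
  The rows \<open>v0\<close> and \<open>v0 + 1\<close> are independent, so a further row outside their span would give three
  independent vectors in a space of dimension 2.
\<close>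

lemma tame_rows_in_span:
  fixes t :: "'a::field tiling"
  assumes "SL2_tiling t" "tame t"
  shows "(\<lambda>u. t (u, v)) \<in> fun_space.span {\<lambda>u. t (u, v0), \<lambda>u. t (u, v0 + 1)}"
proof (rule ccontr)
  let ?r = "\<lambda>v u. t (u, v)"
  assume notin: "?r v \<notin> fun_space.span {?r v0, ?r (v0 + 1)}"
  obtain B where B: "range ?r \<subseteq> fun_space.span B" "card B = fun_space.dim (range ?r)"
    using fun_space.basis_exists by blast
  have card_B: "card B = 2"
    using B(2) assms(2) by (simp add: tame_def tiling_rank_def)
  then have "finite B" using card.infinite by fastforce
  let ?S = "{?r v, ?r v0, ?r (v0 + 1)}"
  have "fun_space.independent ?S"
    using notin SL2_tiling_rows_independent(1)[OF assms(1)] by (rule fun_space.independent_insertI)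
  moreover have "?S \<subseteq> fun_space.span B" using B(1) by blast
  ultimately have "card ?S \<le> 2"
    using fun_space.independent_span_bound[OF \<open>finite B\<close>, of ?S] card_B by simp
  moreover have "?r v \<notin> {?r v0, ?r (v0 + 1)}"
    using notin by (rule contrapos_nn) (rule fun_space.span_base)
  then have "card ?S = 3"
    using SL2_tiling_rows_independent(2)[OF assms(1), of v0] by (simp add: card_insert_if)
  ultimately show False by simp
qed

text \<open>
  Writing the rows in terms of the rows \<open>v0\<close> and \<open>v0 + 1\<close> factorizes the tiling.  The frame
  at \<open>(u0, v0)\<close> takes the stated normal form after a shear by \<open>s\<close>, which adds a multiple of row \<open>v0\<close>
  to row \<open>v0 + 1\<close> so as to kill the entry in column \<open>u0\<close>.  The normal form makes
  factorizations of different tilings comparable.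
\<close>

lemma tame_imp_wedge_tiling:
  fixes t :: "'a::field tiling"
  assumes SL2: "SL2_tiling t" and "tame t" and nz: "t (u0, v0) \<noteq> 0"
  shows "\<exists>w p. unimodular w \<and> unimodular p \<and> t = wedge_tiling w p \<and>
    w v0 = (1, 0) \<and> p u0 = (0, t (u0, v0))"
proof -
  let ?r = "\<lambda>v u. t (u, v)"
  have "\<exists>\<alpha> \<beta>. \<forall>u. t (u, v) = \<alpha> * t (u, v0) + \<beta> * t (u, v0 + 1)" for v
    using in_span_pairD[OF tame_rows_in_span[OF assms(1,2)]] by fast
  then obtain \<alpha> \<beta> where t_eq: "\<And>u v. t (u, v) = \<alpha> v * t (u, v0) + \<beta> v * t (u, v0 + 1)"
    by metis
  have minor: "t (u, v) * t (u + 1, v + 1) - t (u + 1, v) * t (u, v + 1) = 1" for u v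
    using SL2 by (simp add: SL2_tiling_def)
  define s where "s = t (u0, v0 + 1) / t (u0, v0)"
  define p where "p u = (s * t (u, v0) - t (u, v0 + 1), t (u, v0))" for u
  define w where "w v = (\<alpha> v + s * \<beta> v, \<beta> v)" for v
  have "t (u, v) = wedge_tiling w p (u, v)" for u v
    by (subst t_eq) (simp add: wedge_tiling_def wedge_def w_def p_def algebra_simps)
  then have t_wedge: "t = wedge_tiling w p" by (simp add: fun_eq_iff)
  have p: "unimodular p"
    using minor[of _ v0] by (simp add: unimodular_def p_def wedge_def algebra_simps)
  \<comment> \<open>The minors of the tiling are 1 and factorize, and the factor from \<open>p\<close> is already known to be 1.\<close>
  have w: "unimodular w"
    unfolding unimodular_def
  proof
    fix v
    have "wedge (p 0) (p (0 + 1)) * wedge (w v) (w (v + 1)) = 1"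
      using minor[of 0 v] unfolding t_wedge wedge_tiling_minor .
    moreover have "wedge (p 0) (p (0 + 1)) = 1" using p unfolding unimodular_def by blast
    ultimately show "wedge (w v) (w (v + 1)) = 1" by simp
  qed
  have p0: "p u0 = (0, t (u0, v0))" using nz by (simp add: p_def s_def)
  \<comment> \<open>Comparing the entries in columns \<open>u0\<close> and \<open>u0 + 1\<close> of row \<open>v0\<close> determines the vector \<open>w v0\<close>.\<close>
  have "wedge (w v0) (p u0) = t (u0, v0)" by (simp add: t_wedge wedge_tiling_def)
  then have w0: "\<alpha> v0 + s * \<beta> v0 = 1" using nz by (simp add: p0 wedge_def w_def)
  have "wedge (w v0) (p (u0 + 1)) = t (u0 + 1, v0)" by (simp add: t_wedge wedge_tiling_def)
  then have "\<beta> v0 * (s * t (u0 + 1, v0) - t (u0 + 1, v0 + 1)) = 0"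
    by (simp add: w_def p_def wedge_def w0)
  moreover have "(s * t (u0 + 1, v0) - t (u0 + 1, v0 + 1)) * t (u0, v0) = - 1"
    using minor[of u0 v0] nz by (simp add: s_def field_simps)
  ultimately have "\<beta> v0 = 0" by force
  then have "w v0 = (1, 0)" using w0 by (simp add: w_def)
  with p w p0 t_wedge show ?thesis by blast
qed

section \<open>Frames along a frontier\<close>

text \<open>
  A frame \<open>(w, p)\<close> consists of a vector for a row and a vector for a column, and \<open>pairing\<close> is the
  entry of the tiling where they meet.
\<close>

type_synonym 'a frame = "('a \<times> 'a) \<times> ('a \<times> 'a)"

text \<open>
  A letter \<open>X\<close> goes to the next column, a letter \<open>Y\<close> to the previous row (the second axis points
  down), whence the opposite order of the two arguments of \<open>wedge\<close>.
\<close>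

fun move :: "letter \<Rightarrow> 'a::field frame \<Rightarrow> 'a frame \<Rightarrow> bool" where
  "move X (w, p) (w', p') \<longleftrightarrow> w' = w \<and> wedge p p' = 1"
| "move Y (w, p) (w', p') \<longleftrightarrow> p' = p \<and> wedge w' w = 1"

definition pairing :: "'a::field frame \<Rightarrow> 'a" where
  "pairing s = wedge (fst s) (snd s)"

text \<open>
  The vector equation \<open>a p' = b p - w\<close>, with \<open>a\<close> and \<open>b\<close> the old and the new pairing, tested against
  an arbitrary vector \<open>r\<close>.  As \<open>wedge\<close> is nondegenerate, no information is lost.
\<close>

lemma move_X_relation:
  assumes "move X (w, p) (w', p')"
  shows "pairing (w, p) * wedge r p' = pairing (w', p') * wedge r p - wedge r w"
  using assms wedge_pluecker[of r p w p'] 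
  by (simp add: pairing_def algebra_simps wedge_antisym[of p w])

lemma move_forward_unique_X:
  assumes m: "move X s s1" "move X s s2" and eq: "pairing s1 = pairing s2" and nz: "pairing s \<noteq> 0"
  shows "s1 = s2"
proof -
  obtain w p w1 p1 w2 p2 where s: "s = (w, p)" "s1 = (w1, p1)" "s2 = (w2, p2)"
    by (metis surj_pair)
  have "pairing s * wedge r p1 = pairing s * wedge r p2" for r
    using move_X_relation[of w p w1 p1 r] move_X_relation[of w p w2 p2 r] m eq
    by (simp add: s)
  then have "p1 = p2" using nz by (intro wedge_nondegenerate) simp
  with m show ?thesis by (simp add: s)
qed

lemma move_backward_unique_X:
  assumes m: "move X s1 s" "move X s2 s" and eq: "pairing s1 = pairing s2" and nz: "pairing s \<noteq> 0"
  shows "s1 = s2"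
proof -
  obtain w p p1 p2 where s: "s = (w, p)" "s1 = (w, p1)" "s2 = (w, p2)"
    using m by (metis surj_pair move.simps(1))
  have "pairing s * wedge r p1 = pairing s * wedge r p2" for r
    using move_X_relation[of w p1 w p r] move_X_relation[of w p2 w p r] m eq
    by (auto simp: s)
  then have "p1 = p2" using nz by (intro wedge_nondegenerate) simp
  then show ?thesis by (simp add: s)
qed

lemma move_forward_exists_X:
  assumes "pairing s \<noteq> 0"
  shows "\<exists>s'. pairing s' = b \<and> move X s s'"
proof -
  obtain w p where s: "s = (w, p)" by (metis surj_pair)
  \<comment> \<open>The vector \<open>(b p - w) / a\<close>.\<close>
  define p' where "p' = ((b * fst p - fst w) / wedge w p, (b * snd p - snd w) / wedge w p)"
  have wedge_p': "wedge r p' = (b * wedge r p - wedge r w) / wedge w p" for r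
    by (simp add: p'_def wedge_def[of r] divide_inverse algebra_simps)
  have "pairing (w, p') = b" "move X s (w, p')"
    using assms by (simp_all add: s pairing_def wedge_p' wedge_antisym[of p w])
  then show ?thesis by blast
qed

lemma move_backward_exists_X:
  assumes "pairing s \<noteq> 0"
  shows "\<exists>s'. pairing s' = b \<and> move X s' s"
proof -
  obtain w p where s: "s = (w, p)" by (metis surj_pair)
  \<comment> \<open>With the roles of the two column vectors exchanged, the relation reads \<open>a p' = b p + w\<close>.\<close>
  define p' where "p' = ((b * fst p + fst w) / wedge w p, (b * snd p + snd w) / wedge w p)"
  have wedge_p': "wedge r p' = (b * wedge r p + wedge r w) / wedge w p" for r
    by (simp add: p'_def wedge_def[of r] divide_inverse algebra_simps)
  have "pairing (w, p') = b" "move X (w, p') s"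
    using assms by (simp_all add: s pairing_def wedge_p' wedge_antisym[of p' p] wedge_antisym[of p w])
  then show ?thesis by blast
qed

text \<open>
  Exchanging rows and columns turns the frontier around: a vertical move read forwards is a
  horizontal move read backwards.  This reduces all statements about \<open>Y\<close> to those about \<open>X\<close>.
\<close>

definition flip :: "'a frame \<Rightarrow> 'a frame" where
  "flip s = (snd s, fst s)"

lemma flip_flip [simp]: "flip (flip s) = s"
  by (simp add: flip_def)

lemma flip_eq_iff [simp]: "flip s = flip s' \<longleftrightarrow> s = s'"
  by (metis flip_flip)

lemma pairing_flip [simp]: "pairing (flip s) = - pairing s"
  by (simp add: pairing_def flip_def wedge_antisym[of "snd s"])

lemma move_Y_iff_flip: "move Y s s' \<longleftrightarrow> move X (flip s') (flip s)"
  by (cases s; cases s') (auto simp: flip_def)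

lemma move_Y_relation:
  assumes "move Y (w, p) (w', p')"
  shows "pairing (w, p) * wedge r w' = pairing (w', p') * wedge r w - wedge r p"
  using assms move_X_relation[of p' w' p w r] move_Y_iff_flip[of "(w, p)" "(w', p')"]
    pairing_flip[of "(w, p)"] pairing_flip[of "(w', p')"]
  by (simp add: flip_def algebra_simps)

lemma move_forward_unique:
  assumes "move c s s1" "move c s s2" "pairing s1 = pairing s2" "pairing s \<noteq> 0"
  shows "s1 = s2"
proof (cases c)
  case X
  with assms show ?thesis by (blast intro: move_forward_unique_X)
next
  case Y
  with assms have "flip s1 = flip s2"
    by (intro move_backward_unique_X[of _ "flip s"]) (simp_all add: move_Y_iff_flip)
  then show ?thesis by simp
qed

lemma move_backward_unique:
  assumes "move c s1 s" "move c s2 s" "pairing s1 = pairing s2" "pairing s \<noteq> 0"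
  shows "s1 = s2"
proof (cases c)
  case X
  with assms show ?thesis by (blast intro: move_backward_unique_X)
next
  case Y
  with assms have "flip s1 = flip s2"
    by (intro move_forward_unique_X[of "flip s"]) (simp_all add: move_Y_iff_flip)
  then show ?thesis by simp
qed

lemma move_forward_exists:
  assumes "pairing s \<noteq> 0"
  shows "\<exists>s'. pairing s' = b \<and> move c s s'"
proof (cases c)
  case X
  with assms move_forward_exists_X show ?thesis by blast
next
  case Y
  obtain s' where "pairing s' = - b" "move X s' (flip s)"
    using move_backward_exists_X[of "flip s" "- b"] assms by auto
  then have "pairing (flip s') = b \<and> move c s (flip s')"
    by (simp add: Y move_Y_iff_flip)
  then show ?thesis by blast
qed

lemma move_backward_exists:
  assumes "pairing s \<noteq> 0"
  shows "\<exists>s'. pairing s' = b \<and> move c s' s"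
proof (cases c)
  case X
  with assms move_backward_exists_X show ?thesis by blast
next
  case Y
  obtain s' where "pairing s' = - b" "move X (flip s) s'"
    using move_forward_exists_X[of "flip s" "- b"] assms by auto
  then have "pairing (flip s') = b \<and> move c (flip s') s"
    by (simp add: Y move_Y_iff_flip)
  then show ?thesis by blast
qed


definition framing :: "(int \<Rightarrow> letter) \<Rightarrow> (int \<Rightarrow> 'a::field) \<Rightarrow> (int \<Rightarrow> 'a frame) \<Rightarrow> bool" where
  "framing x a s \<longleftrightarrow> (\<forall>i. pairing (s i) = a i \<and> move (x i) (s (i - 1)) (s i))"

text \<open>
  Dependent choice along the integers: the relation \<open>R i\<close> links the elements chosen for \<open>i - 1\<close>
  and \<open>i\<close>, and choices can be continued in both directions from the one at 0.
\<close>

lemma int_dependent_choice: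
  fixes Q :: "int \<Rightarrow> 's \<Rightarrow> bool"
  assumes base: "Q 0 s0"
    and forward: "\<And>i s. Q i s \<Longrightarrow> \<exists>s'. Q (i + 1) s' \<and> R (i + 1) s s'"
    and backward: "\<And>i s. Q i s \<Longrightarrow> \<exists>s'. Q (i - 1) s' \<and> R i s' s"
  shows "\<exists>f. f 0 = s0 \<and> (\<forall>i. Q i (f i) \<and> R i (f (i - 1)) (f i))"
proof -
  have "\<exists>g. \<forall>n. (Q (int n) (g n) \<and> (n = 0 \<longrightarrow> g n = s0)) \<and> R (int n + 1) (g n) (g (Suc n))"
  proof (rule dependent_nat_choice)
    show "\<exists>s. Q (int 0) s \<and> (0 = 0 \<longrightarrow> s = s0)" using base by simp
    fix s n assume "Q (int n) s \<and> (n = 0 \<longrightarrow> s = s0)"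
    then show "\<exists>s'. (Q (int (Suc n)) s' \<and> (Suc n = 0 \<longrightarrow> s' = s0)) \<and> R (int n + 1) s s'"
      using forward[of "int n" s] by (simp add: add.commute)
  qed
  then obtain g where g: "\<And>n. Q (int n) (g n)" "g 0 = s0" "\<And>n. R (int n + 1) (g n) (g (Suc n))"
    by auto
  have "\<exists>h. \<forall>n. (Q (- int n) (h n) \<and> (n = 0 \<longrightarrow> h n = s0)) \<and> R (- int n) (h (Suc n)) (h n)"
  proof (rule dependent_nat_choice)
    show "\<exists>s. Q (- int 0) s \<and> (0 = 0 \<longrightarrow> s = s0)" using base by simp
    fix s n
    have neg: "- int (Suc n) = - int n - 1" by simp
    assume "Q (- int n) s \<and> (n = 0 \<longrightarrow> s = s0)"
    then show "\<exists>s'. (Q (- int (Suc n)) s' \<and> (Suc n = 0 \<longrightarrow> s' = s0)) \<and> R (- int n) s' s"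
      using backward[of "- int n" s] unfolding neg by simp
  qed
  then obtain h where h: "\<And>n. Q (- int n) (h n)" "h 0 = s0" "\<And>n. R (- int n) (h (Suc n)) (h n)"
    by auto
  define f where "f i = (if i \<ge> 0 then g (nat i) else h (nat (- i)))" for i
  have f_neg: "f (- int n) = h n" for n by (cases n) (simp_all add: f_def g h nat_add_distrib)
  have "Q i (f i) \<and> R i (f (i - 1)) (f i)" for i
  proof (cases "i > 0")
    case True
    define n where "n = nat (i - 1)"
    with True have "i = int n + 1" by simp
    then show ?thesis using g(1)[of "Suc n"] g(3)[of n] by (simp add: f_def nat_add_distrib add.commute)
  next
    case False
    define n where "n = nat (- i)"
    with False have i: "i = - int n" "i - 1 = - int (Suc n)" by simp_all
    show ?thesis unfolding i(2) unfolding i(1) f_neg using h by blast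
  qed
  moreover have "f 0 = s0" by (simp add: f_def g)
  ultimately show ?thesis by blast
qed

lemma framing_exists:
  fixes a :: "int \<Rightarrow> 'a::field"
  assumes nz: "\<And>i. a i \<noteq> 0"
  shows "\<exists>s. framing x a s"
proof -
  let ?s0 = "((1, 0), (0, a 0))"
  have "\<exists>s. s 0 = ?s0 \<and> (\<forall>i. pairing (s i) = a i \<and> move (x i) (s (i - 1)) (s i))"
  proof (rule int_dependent_choice)
    show "pairing ?s0 = a 0" by (simp add: pairing_def wedge_def)
    fix i s assume "pairing s = a i"
    then have "pairing s \<noteq> 0" using nz by simp
    then show "\<exists>s'. pairing s' = a (i + 1) \<and> move (x (i + 1)) s s'"
      and "\<exists>s'. pairing s' = a (i - 1) \<and> move (x i) s' s"
      by (rule move_forward_exists, rule move_backward_exists)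
  qed
  then show ?thesis unfolding framing_def by blast
qed

lemma framing_unique:
  assumes nz: "\<And>i. a i \<noteq> 0" and f: "framing x a s" "framing x a s'" and "s 0 = s' 0"
  shows "s i = s' i"
proof -
  have pairing: "pairing (s i) = a i" "pairing (s' i) = a i"
    and moves: "move (x i) (s (i - 1)) (s i)" "move (x i) (s' (i - 1)) (s' i)" for i
    using f unfolding framing_def by blast+
  show ?thesis
  proof (induction i rule: int_induct[where k = 0])
    case base
    show ?case by fact
  next
    case (step1 i)
    show ?case
    proof (rule move_forward_unique)
      show "move (x (i + 1)) (s i) (s (i + 1))" "move (x (i + 1)) (s i) (s' (i + 1))"
        using moves[of "i + 1"] step1 by simp_all
    qed (simp_all add: pairing nz)
  next
    case (step2 i)
    show ?case
    proof (rule move_backward_unique)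
      show "move (x i) (s (i - 1)) (s i)" "move (x i) (s' (i - 1)) (s i)"
        using moves[of i] step2 by simp_all
    qed (simp_all add: pairing nz)
  qed
qed

section \<open>The word formula\<close>

lemma row_times_mu:
  fixes r1 r2 :: "'a::field"
  shows "(vector [vector [r1, r2]] :: 'a^2^1) ** mu a X b = vector [vector [r1 * a, r1 + r2 * b]]"
    and "(vector [vector [r1, r2]] :: 'a^2^1) ** mu a Y b = vector [vector [r1 * b + r2, r2 * a]]"
  by (simp_all add: vec_eq_iff matrix_matrix_mult_def forall_1 forall_2 sum_2 del: One_nat_def)

lemma row_times_column:
  "((vector [vector [r1, r2]] :: 'a::field^2^1) ** (vector [vector [c1], vector [c2]] :: 'a^1^2)) $ 1 $ 1
    = r1 * c1 + r2 * c2"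
  by (simp add: matrix_matrix_mult_def sum_2)

lemma matrix_prod_snoc: "matrix_prod (Ms @ [M]) = matrix_prod Ms ** M"
proof -
  have "foldr (**) Ms N = matrix_prod Ms ** N" for N :: "'a::field^2^2"
    by (induction Ms) (simp_all add: matrix_prod_def matrix_mul_assoc)
  then show ?thesis unfolding matrix_prod_def[of "Ms @ [M]"] by simp
qed

text \<open>
  The row vector that has passed through the first \<open>m - 1\<close> matrices holds the coordinates of
  \<open>b 1 \<dots> b m\<close> times \<open>W 0\<close> in the basis \<open>Q m, W m\<close>: multiplication by \<open>mu\<close> is the change to
  the next frame, up to a scalar.  It starts with the coordinates \<open>(1, b 0)\<close>
  because the first step is vertical, so that \<open>Q 1 = Q 0\<close> and \<open>wedge (W 1) (W 0) = 1\<close>.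
\<close>

lemma word_row:
  fixes W Q :: "nat \<Rightarrow> 'a::field \<times> 'a"
  assumes moves: "\<And>k. move (z (Suc k)) (W k, Q k) (W (Suc k), Q (Suc k))"
    and pairing: "\<And>k. pairing (W k, Q k) = b k" and z1: "z 1 = Y" and "m \<ge> 1"
  shows "(vector [vector [1, b 0]] :: 'a^2^1)
      ** matrix_prod (map (\<lambda>k. mu (b k) (z (k + 1)) (b (k + 1))) [1..<m])
    = vector [vector [(\<Prod>k=1..<m. b k) * wedge (W m) (W 0), (\<Prod>k=1..<m. b k) * wedge (W 0) (Q m)]]"
  using \<open>m \<ge> 1\<close>
proof (induction m rule: nat_induct_at_least)
  case base
  have "Q 1 = Q 0" "wedge (W 1) (W 0) = 1" using moves[of 0] z1 by simp_all
  then show ?case using pairing[of 0] by (simp add: matrix_prod_def pairing_def)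
next
  case (Suc m)
  let ?c = "\<Prod>k=1..<m. b k"
  have "(vector [vector [1, b 0]] :: 'a^2^1)
      ** matrix_prod (map (\<lambda>k. mu (b k) (z (k + 1)) (b (k + 1))) [1..<Suc m])
    = vector [vector [?c * wedge (W m) (W 0), ?c * wedge (W 0) (Q m)]]
      ** mu (b m) (z (Suc m)) (b (Suc m))"
    using Suc by (simp add: matrix_prod_snoc matrix_mul_assoc)
  also have "\<dots> = vector [vector [?c * b m * wedge (W (Suc m)) (W 0), ?c * b m * wedge (W 0) (Q (Suc m))]]"
  proof (cases "z (Suc m)")
    case X
    then have W: "W (Suc m) = W m" using moves[of m] by simp
    have "b m * wedge (W 0) (Q (Suc m)) = b (Suc m) * wedge (W 0) (Q m) + wedge (W m) (W 0)"
      using move_X_relation[of "W m" "Q m" "W (Suc m)" "Q (Suc m)" "W 0"] moves[of m] X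
        pairing[of m] pairing[of "Suc m"] wedge_antisym[of "W 0" "W m"] by simp
    then have "?c * b m * wedge (W 0) (Q (Suc m))
        = ?c * wedge (W m) (W 0) + ?c * wedge (W 0) (Q m) * b (Suc m)"
      unfolding mult.assoc by (simp only: algebra_simps)
    then show ?thesis unfolding X row_times_mu W by (simp only: mult.assoc mult.commute[of "b m"])
  next
    case Y
    then have Q: "Q (Suc m) = Q m" using moves[of m] by simp
    have "b m * wedge (W (Suc m)) (W 0) = b (Suc m) * wedge (W m) (W 0) + wedge (W 0) (Q m)"
      using move_Y_relation[of "W m" "Q m" "W (Suc m)" "Q (Suc m)" "W 0"] moves[of m] Y
        pairing[of m] pairing[of "Suc m"]
        wedge_antisym[of "W 0" "W m"] wedge_antisym[of "W 0" "W (Suc m)"]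
      by (simp add: algebra_simps)
    then have "?c * b m * wedge (W (Suc m)) (W 0)
        = ?c * wedge (W m) (W 0) * b (Suc m) + ?c * wedge (W 0) (Q m)"
      unfolding mult.assoc by (simp only: algebra_simps)
    then show ?thesis unfolding Y row_times_mu Q by (simp only: mult.assoc mult.commute[of "b m"])
  qed
  finally show ?case using Suc.hyps by (simp add: mult.commute)
qed

text \<open>
  The column \<open>(1, b (n + 1))\<close> performs the last step, which is horizontal: it gives the wedge of
  \<open>W 0\<close> with \<open>b n\<close> times the new column vector, by the relation \<open>a p' = b p - w\<close>.
\<close>

lemma word_value_eq_wedge:
  fixes W Q :: "nat \<Rightarrow> 'a::field \<times> 'a"
  assumes moves: "\<And>k. move (z (Suc k)) (W k, Q k) (W (Suc k), Q (Suc k))"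
    and pairing: "\<And>k. pairing (W k, Q k) = b k" and nz: "\<And>k. b k \<noteq> 0"
    and "z 1 = Y" and zn: "z (n + 1) = X" and "n \<ge> 1"
  shows "word_value n z b = wedge (W 0) (Q (n + 1))"
proof -
  let ?c = "\<Prod>k=1..<n. b k"
  have prod: "(\<Prod>k=1..n. b k) = ?c * b n"
  proof -
    have "{1..n} = insert n {1..<n}" using \<open>n \<ge> 1\<close> by auto
    then show ?thesis by (simp add: mult.commute)
  qed
  have "b n * wedge (W 0) (Q (n + 1)) = b (n + 1) * wedge (W 0) (Q n) + wedge (W n) (W 0)"
    using move_X_relation[of "W n" "Q n" "W (n + 1)" "Q (n + 1)" "W 0"] moves[of n] zn
      pairing[of n] pairing[of "n + 1"] wedge_antisym[of "W 0" "W n"] by simp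
  then have "?c * wedge (W n) (W 0) + ?c * wedge (W 0) (Q n) * b (n + 1)
      = ?c * b n * wedge (W 0) (Q (n + 1))"
    unfolding mult.assoc by (simp only: algebra_simps)
  moreover have "?c * b n \<noteq> 0" using nz by simp
  ultimately show ?thesis
    unfolding word_value_def word_row[OF moves pairing \<open>z 1 = Y\<close> \<open>n \<ge> 1\<close>] row_times_column prod
    by simp
qed

section \<open>Geometry of an admissible frontier\<close>

text \<open>
  A discrete intermediate value theorem, which also provides a jump to the value \<open>n\<close>: it is the
  first index with this value.  It applies to the column numbers of a frontier and to the
  negated row numbers.
\<close>

lemma unit_step_crossing:
  fixes f :: "int \<Rightarrow> int"
  assumes unit_step: "\<And>i. f i = f (i - 1) \<or> f i = f (i - 1) + 1"
    and up: "\<And>N. \<exists>i\<ge>N. f i \<noteq> f (i - 1)" and down: "\<And>N. \<exists>i\<le>N. f i \<noteq> f (i - 1)"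
  shows "\<exists>i. f (i - 1) = n - 1 \<and> f i = n"
proof -
  have mono: "f i \<le> f j" if "i \<le> j" for i j
    using that
  proof (induction j rule: int_ge_induct)
    case (step j)
    then show ?case using unit_step[of "j + 1"] by auto
  qed simp
  have "\<exists>i. f i \<ge> f 0 + int k" for k
  proof (induction k)
    case (Suc k)
    then obtain i where i: "f i \<ge> f 0 + int k" by blast
    obtain j where "j \<ge> i + 1" "f j \<noteq> f (j - 1)" using up by blast
    then show ?case using unit_step[of j] mono[of i "j - 1"] i by (intro exI[of _ j]) auto
  qed auto
  then obtain i1 where "f i1 \<ge> f 0 + int (nat (n - f 0))" by blast
  then have i1: "f i1 \<ge> n" by linarith
  have "\<exists>i. f i \<le> f 0 - int k" for k
  proof (induction k)
    case (Suc k)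
    then obtain i where i: "f i \<le> f 0 - int k" by blast
    obtain j where "j \<le> i" "f j \<noteq> f (j - 1)" using down by blast
    then show ?case using unit_step[of j] mono[of j i] i by (intro exI[of _ "j - 1"]) auto
  qed auto
  then obtain i0 where "f i0 \<le> f 0 - int (nat (f 0 - n + 1))" by blast
  then have i0: "f i0 < n" by linarith
  have "f j \<ge> n \<longrightarrow> (\<exists>i. f (i - 1) = n - 1 \<and> f i = n)" if "i0 \<le> j" for j
    using that
  proof (induction j rule: int_ge_induct)
    case base
    show ?case using i0 by simp
  next
    case (step j)
    show ?case
    proof (cases "f j \<ge> n")
      case False
      then show ?thesis using unit_step[of "j + 1"] by (intro impI exI[of _ "j + 1"]) auto
    qed (use step in blast)
  qed
  moreover have "i0 \<le> i1" using mono[of i1 i0] i0 i1 by linarith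
  ultimately show ?thesis using i1 by blast
qed

locale frontier =
  fixes x :: "int \<Rightarrow> letter" and P :: "int \<Rightarrow> int \<times> int"
  assumes admissible: "admissible x" and embedding: "embedding x P"
begin

abbreviation ucoord :: "int \<Rightarrow> int" where "ucoord i \<equiv> fst (P i)"
abbreviation vcoord :: "int \<Rightarrow> int" where "vcoord i \<equiv> snd (P i)"

lemma step_X: "x i = X \<Longrightarrow> ucoord i = ucoord (i - 1) + 1 \<and> vcoord i = vcoord (i - 1)"
  using embedding unfolding embedding_def by (metis fst_conv snd_conv letter.simps(3))

lemma step_Y: "x i = Y \<Longrightarrow> ucoord i = ucoord (i - 1) \<and> vcoord i = vcoord (i - 1) - 1"
  using embedding unfolding embedding_def by (metis fst_conv snd_conv letter.simps(4))

text \<open>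
  There are only two letters, so a letter that stopped recurring would leave the other one constant.
\<close>

lemma letter_recurs: "\<exists>i\<ge>N. x i = c" "\<exists>i\<le>N. x i = c"
proof -
  obtain d where d: "\<And>e. e \<noteq> c \<Longrightarrow> e = d" by (metis letter.exhaust)
  have "\<not> (\<forall>i\<ge>N. x i = d)" "\<not> (\<forall>i\<le>N. x i = d)"
    using admissible unfolding admissible_def eventually_at_top_linorder eventually_at_bot_linorder
    by blast+
  then show "\<exists>i\<ge>N. x i = c" "\<exists>i\<le>N. x i = c" using d by blast+
qed

lemma col_crossing: "\<exists>j. ucoord (j - 1) = u - 1 \<and> ucoord j = u"
proof (rule unit_step_crossing)
  show "ucoord i = ucoord (i - 1) \<or> ucoord i = ucoord (i - 1) + 1" for i
    using step_X step_Y by (cases "x i") auto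
  show "\<exists>i\<ge>N. ucoord i \<noteq> ucoord (i - 1)" for N
    using letter_recurs(1)[of N X] step_X by fastforce
  show "\<exists>i\<le>N. ucoord i \<noteq> ucoord (i - 1)" for N
    using letter_recurs(2)[of N X] step_X by fastforce
qed

lemma row_crossing: "\<exists>i. vcoord i = v \<and> vcoord (i + 1) = v - 1"
proof -
  have "\<exists>i. - vcoord (i - 1) = (1 - v) - 1 \<and> - vcoord i = 1 - v"
  proof (rule unit_step_crossing)
    show "- vcoord i = - vcoord (i - 1) \<or> - vcoord i = - vcoord (i - 1) + 1" for i
      using step_X step_Y by (cases "x i") auto
    show "\<exists>i\<ge>N. - vcoord i \<noteq> - vcoord (i - 1)" for N
      using letter_recurs(1)[of N Y] step_Y by fastforce
    show "\<exists>i\<le>N. - vcoord i \<noteq> - vcoord (i - 1)" for N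
      using letter_recurs(2)[of N Y] step_Y by fastforce
  qed
  then obtain i where "vcoord (i - 1) = v" "vcoord i = v - 1" by auto
  then show ?thesis by (intro exI[of _ "i - 1"]) simp
qed

lemma col_mono: "i \<le> j \<Longrightarrow> ucoord i \<le> ucoord j"
proof (induction j rule: int_ge_induct)
  case (step j)
  then show ?case using step_X[of "j + 1"] step_Y[of "j + 1"] by (cases "x (j + 1)") auto
qed simp

lemma row_antimono: "i \<le> j \<Longrightarrow> vcoord j \<le> vcoord i"
proof (induction j rule: int_ge_induct)
  case (step j)
  then show ?case using step_X[of "j + 1"] step_Y[of "j + 1"] by (cases "x (j + 1)") auto
qed simp

lemma up_index:
  shows "ucoord (up_index P u) = u" and "x (up_index P u) = X"
proof -
  obtain j where j: "ucoord (j - 1) = u - 1" "ucoord j = u" using col_crossing by blast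
  have "up_index P u = j"
    unfolding up_index_def
  proof (rule Least_equality)
    fix k assume "ucoord k = u"
    then show "j \<le> k" using col_mono[of k "j - 1"] j by linarith
  qed (fact j)
  moreover have "x j = X" using step_Y[of j] j by (cases "x j") auto
  ultimately show "ucoord (up_index P u) = u" "x (up_index P u) = X" using j by simp_all
qed

lemma left_index:
  shows "vcoord (left_index P v) = v" and "x (left_index P v + 1) = Y"
proof -
  obtain i where i: "vcoord i = v" "vcoord (i + 1) = v - 1" using row_crossing by blast
  have "left_index P v = i"
    unfolding left_index_def
  proof (rule Greatest_equality)
    fix k assume "vcoord k = v"
    then show "k \<le> i" using row_antimono[of "i + 1" k] i by linarith
  qed (fact i)
  moreover have "x (i + 1) = Y" using step_X[of "i + 1"] i by (cases "x (i + 1)") auto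
  ultimately show "vcoord (left_index P v) = v" "x (left_index P v + 1) = Y" using i by simp_all
qed

text \<open>
  Let \<open>i\<close> be the last index in row \<open>v\<close> and \<open>j\<close> the first index in column \<open>u\<close>.  As \<open>(u, v)\<close> is below
  the frontier, column \<open>u\<close> contains a frontier point above row \<open>v\<close>, whose index is larger than \<open>i\<close>.
  If \<open>j \<le> i\<close>, then the point with index \<open>i\<close> lies between two points of column \<open>u\<close>, so it is \<open>(u, v)\<close>,
  which is not on the frontier.
  Moreover \<open>j \<noteq> i + 1\<close>, because the letter after \<open>a i\<close> is \<open>Y\<close> and the letter before \<open>a j\<close> is \<open>X\<close>.
\<close>

lemma below_index_gap:
  assumes "below P (u, v)"
  obtains n where "n \<ge> 1" "up_index P u = left_index P v + int (n + 1)"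
proof -
  let ?i = "left_index P v" and ?j = "up_index P u"
  obtain k where k: "ucoord k = u" "vcoord k < v" and off: "(u, v) \<notin> range P"
    using assms by (auto simp: below_def)
  have "?i < k" using row_antimono[of k ?i] k left_index(1)[of v] by linarith
  have "?i < ?j"
  proof (rule ccontr)
    assume "\<not> ?i < ?j"
    then have "u \<le> ucoord ?i" "ucoord ?i \<le> u"
      using col_mono[of ?j ?i] col_mono[of ?i k] up_index(1)[of u] k \<open>?i < k\<close> by simp_all
    then have "P ?i = (u, v)" using left_index(1)[of v] by (simp add: prod_eq_iff)
    with off show False by (metis rangeI)
  qed
  moreover have "?j \<noteq> ?i + 1" using left_index(2)[of v] up_index(2)[of u] by auto
  ultimately have "nat (?j - ?i - 1) \<ge> 1" "?j = ?i + int (nat (?j - ?i - 1) + 1)" by simp_all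
  then show thesis by (rule that)
qed

lemma framing_of_wedge_tiling:
  assumes "unimodular w" "unimodular p" "extends_frontier (wedge_tiling w p) P a"
  shows "framing x a (\<lambda>i. (w (vcoord i), p (ucoord i)))"
  unfolding framing_def
proof (intro allI conjI)
  fix i
  show "pairing (w (vcoord i), p (ucoord i)) = a i"
    using assms(3) by (simp add: extends_frontier_def wedge_tiling_def pairing_def split_beta)
  show "move (x i) (w (vcoord (i - 1)), p (ucoord (i - 1))) (w (vcoord i), p (ucoord i))"
  proof (cases "x i")
    case X
    then show ?thesis using step_X[OF X] assms(2) by (simp add: unimodular_def)
  next
    case Y
    then have "vcoord (i - 1) = vcoord i + 1" "ucoord i = ucoord (i - 1)"
      using step_Y by simp_all
    moreover have "wedge (w (vcoord i)) (w (vcoord i + 1)) = 1"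
      using assms(1) unfolding unimodular_def by blast
    ultimately show ?thesis using Y by simp
  qed
qed

text \<open>
  Along a row only \<open>X\<close> occurs, so the row vector does not change, and likewise for columns.  Hence
  the frames define one vector for each row and each column, and unimodularity is seen where
  the frontier passes from one row or column to the next.
\<close>

lemma wedge_tiling_of_framing:
  assumes "framing x a s"
  shows "\<exists>w p. unimodular w \<and> unimodular p \<and> s = (\<lambda>i. (w (vcoord i), p (ucoord i)))"
proof -
  have move: "move (x i) (s (i - 1)) (s i)" for i
    using assms by (simp add: framing_def)
  have X: "fst (s i) = fst (s (i - 1))" "wedge (snd (s (i - 1))) (snd (s i)) = 1" if "x i = X" for i
    using move[of i] that by (cases "s i"; cases "s (i - 1)"; simp)+
  have Y: "snd (s i) = snd (s (i - 1))" "wedge (fst (s i)) (fst (s (i - 1))) = 1" if "x i = Y" for i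
    using move[of i] that by (cases "s i"; cases "s (i - 1)"; simp)+
  have "i \<le> j \<Longrightarrow> vcoord i = vcoord j \<longrightarrow> fst (s i) = fst (s j)" for i j
  proof (induction j rule: int_ge_induct)
    case (step j)
    then show ?case
      using step_Y[of "j + 1"] step_X[of "j + 1"] X(1)[of "j + 1"] row_antimono[of i j]
      by (cases "x (j + 1)") auto
  qed simp
  then have row_eq: "fst (s i) = fst (s j)" if "vcoord i = vcoord j" for i j
    using that by (metis linear)
  have "i \<le> j \<Longrightarrow> ucoord i = ucoord j \<longrightarrow> snd (s i) = snd (s j)" for i j
  proof (induction j rule: int_ge_induct)
    case (step j)
    then show ?case
      using step_Y[of "j + 1"] step_X[of "j + 1"] Y(1)[of "j + 1"] col_mono[of i j]
      by (cases "x (j + 1)") auto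
  qed simp
  then have col_eq: "snd (s i) = snd (s j)" if "ucoord i = ucoord j" for i j
    using that by (metis linear)
  define w where "w v = fst (s (left_index P v))" for v
  define p where "p u = snd (s (up_index P u))" for u
  have w: "w (vcoord i) = fst (s i)" for i
    unfolding w_def by (intro row_eq left_index)
  have p: "p (ucoord i) = snd (s i)" for i
    unfolding p_def by (intro col_eq up_index)
  have "unimodular w"
    unfolding unimodular_def
  proof
    fix v
    let ?i = "left_index P (v + 1)"
    have i: "vcoord ?i = v + 1" "vcoord (?i + 1) = v"
      using left_index[of "v + 1"] step_Y[of "?i + 1"] by simp_all
    have "wedge (fst (s (?i + 1))) (fst (s ?i)) = 1"
      using Y(2)[of "?i + 1"] left_index(2)[of "v + 1"] by simp
    then show "wedge (w v) (w (v + 1)) = 1" using w[of ?i] w[of "?i + 1"] i by simp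
  qed
  moreover have "unimodular p"
    unfolding unimodular_def
  proof
    fix u
    let ?j = "up_index P (u + 1)"
    have j: "ucoord ?j = u + 1" "ucoord (?j - 1) = u"
      using up_index[of "u + 1"] step_X[of ?j] by simp_all
    have "wedge (snd (s (?j - 1))) (snd (s ?j)) = 1"
      using X(2)[of ?j] up_index(2)[of "u + 1"] by simp
    then show "wedge (p u) (p (u + 1)) = 1" using p[of ?j] p[of "?j - 1"] j by simp
  qed
  moreover have "s = (\<lambda>i. (w (vcoord i), p (ucoord i)))" by (simp add: w p)
  ultimately show ?thesis by blast
qed

lemma tame_extension_exists:
  fixes a :: "int \<Rightarrow> 'a::field"
  assumes "\<And>i. a i \<noteq> 0"
  shows "\<exists>t. SL2_tiling t \<and> tame t \<and> extends_frontier t P a"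
proof -
  obtain s where s: "framing x a s" using framing_exists[where a = a] assms by blast
  then obtain w p where wp: "unimodular w" "unimodular p" "s = (\<lambda>i. (w (vcoord i), p (ucoord i)))"
    using wedge_tiling_of_framing by blast
  have "extends_frontier (wedge_tiling w p) P a"
    using s unfolding wp framing_def
    by (simp add: extends_frontier_def wedge_tiling_def pairing_def split_beta)
  then show ?thesis using wedge_tiling_tame[OF wp(1,2)] by blast
qed

text \<open>
  Both tilings get the same normalized frame at the point with index 0, hence the same frames along
  the frontier, and the frontier meets every row and every column.
\<close>

lemma tame_extension_unique:
  fixes a :: "int \<Rightarrow> 'a::field"
  assumes nz: "\<And>i. a i \<noteq> 0"
    and t: "SL2_tiling t" "tame t" "extends_frontier t P a"
    and t': "SL2_tiling t'" "tame t'" "extends_frontier t' P a"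
  shows "t = t'"
proof -
  have origin: "t (ucoord 0, vcoord 0) = a 0" "t' (ucoord 0, vcoord 0) = a 0"
    using t(3) t'(3) by (simp_all add: extends_frontier_def)
  obtain w p where wp: "unimodular w" "unimodular p" "t = wedge_tiling w p"
      "w (vcoord 0) = (1, 0)" "p (ucoord 0) = (0, a 0)"
    using tame_imp_wedge_tiling[OF t(1,2), of "ucoord 0" "vcoord 0"] origin nz by auto
  obtain w' p' where wp': "unimodular w'" "unimodular p'" "t' = wedge_tiling w' p'"
      "w' (vcoord 0) = (1, 0)" "p' (ucoord 0) = (0, a 0)"
    using tame_imp_wedge_tiling[OF t'(1,2), of "ucoord 0" "vcoord 0"] origin nz by auto
  have "framing x a (\<lambda>i. (w (vcoord i), p (ucoord i)))"
    using framing_of_wedge_tiling[OF wp(1,2)] t(3) wp(3) by blast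
  moreover have "framing x a (\<lambda>i. (w' (vcoord i), p' (ucoord i)))"
    using framing_of_wedge_tiling[OF wp'(1,2)] t'(3) wp'(3) by blast
  ultimately have eq: "(w (vcoord i), p (ucoord i)) = (w' (vcoord i), p' (ucoord i))" for i
    by (rule framing_unique[where a = a, OF nz]) (simp add: wp wp')
  have "w v = w' v" for v using eq[of "left_index P v"] left_index(1)[of v] by simp
  moreover have "p u = p' u" for u using eq[of "up_index P u"] up_index(1)[of u] by simp
  ultimately show ?thesis by (simp add: wp wp' wedge_tiling_def)
qed

lemma tame_extension_word_value:
  fixes a :: "int \<Rightarrow> 'a::field"
  assumes nz: "\<And>i. a i \<noteq> 0"
    and t: "SL2_tiling t" "tame t" "extends_frontier t P a" and n: "n \<ge> 1"
    and gap: "up_index P u = left_index P v + int (n + 1)"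
  shows "t (u, v) = word_value n (\<lambda>k. x (left_index P v + int k)) (\<lambda>k. a (left_index P v + int k))"
proof -
  let ?i = "left_index P v"
  have "t (ucoord 0, vcoord 0) \<noteq> 0" using t(3) nz by (simp add: extends_frontier_def)
  then obtain w p where wp: "unimodular w" "unimodular p" "t = wedge_tiling w p"
    using tame_imp_wedge_tiling[OF t(1,2)] by blast
  have framing: "framing x a (\<lambda>i. (w (vcoord i), p (ucoord i)))"
    using framing_of_wedge_tiling wp t(3) by blast
  then have moves: "move (x k) (w (vcoord (k - 1)), p (ucoord (k - 1))) (w (vcoord k), p (ucoord k))"
    for k unfolding framing_def by blast
  have "word_value n (\<lambda>k. x (?i + int k)) (\<lambda>k. a (?i + int k))
      = wedge (w (vcoord (?i + int 0))) (p (ucoord (?i + int (n + 1))))"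
  proof (rule word_value_eq_wedge)
    show "move (x (?i + int (Suc k))) (w (vcoord (?i + int k)), p (ucoord (?i + int k)))
        (w (vcoord (?i + int (Suc k))), p (ucoord (?i + int (Suc k))))" for k
    proof -
      have pred: "?i + int (Suc k) - 1 = ?i + int k" by simp
      show ?thesis using moves[of "?i + int (Suc k)"] unfolding pred .
    qed
    show "pairing (w (vcoord (?i + int k)), p (ucoord (?i + int k))) = a (?i + int k)" for k
      using framing unfolding framing_def by blast
    show "x (?i + int 1) = Y" using left_index(2) by simp
    show "x (?i + int (n + 1)) = X" using up_index(2)[of u] gap by simp
  qed (use nz n in auto)
  also have "\<dots> = t (u, v)"
    using left_index(1)[of v] up_index(1)[of u] gap by (simp add: wp wedge_tiling_def)
  finally show ?thesis by simp
qed

end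

theorem theorem3p1:
  fixes x :: "int \<Rightarrow> letter" and a :: "int \<Rightarrow> 'a::field" and P :: "int \<Rightarrow> int \<times> int"
  assumes "\<And>i. a i \<noteq> 0" and "admissible x" and "embedding x P"
  shows "(\<exists>!t :: 'a tiling. SL2_tiling t \<and> tame t \<and> extends_frontier t P a) \<and>
    (\<forall>t :: 'a tiling. SL2_tiling t \<and> tame t \<and> extends_frontier t P a \<longrightarrow>
      (\<forall>u v. below P (u, v) \<longrightarrow>
        (let i = left_index P v; j = up_index P u in
          \<exists>n\<ge>1. j = i + int (n + 1) \<and>
            t (u, v) = word_value n (\<lambda>k. x (i + int k)) (\<lambda>k. a (i + int k)))))"
proof -
  interpret frontier x P using assms(2,3) by unfold_locales
  show ?thesis
  proof (intro conjI allI impI)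
    show "\<exists>!t :: 'a tiling. SL2_tiling t \<and> tame t \<and> extends_frontier t P a"
      using tame_extension_exists[of a] tame_extension_unique[of a] assms(1) by blast
  next
    fix t :: "'a tiling" and u v
    assume t: "SL2_tiling t \<and> tame t \<and> extends_frontier t P a" and "below P (u, v)"
    then obtain n where "n \<ge> 1" "up_index P u = left_index P v + int (n + 1)"
      using below_index_gap by blast
    then show "let i = left_index P v; j = up_index P u in
        \<exists>n\<ge>1. j = i + int (n + 1) \<and>
          t (u, v) = word_value n (\<lambda>k. x (i + int k)) (\<lambda>k. a (i + int k))"
      using tame_extension_word_value[of a t n u v] assms(1) t by (auto simp: Let_def)
  qed
qed

end
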